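(* For every $A\in\mathbb{Q}_s^{m\times n}$, the matrix $A^\dagger:=\sigma^{-1}\!\left((A^\sigma)^\dagger\right)\in\mathbb{Q}_s^{n\times m}$ is the unique matrix $X\in\mathbb{Q}_s^{n\times m}$ satisfying $$AXA=A,\qquad XAX=X,\qquad (AX)^H=AX,\qquad (XA)^H=XA .$$ Moreover, $(A^\dagger)^\sigma=(A^\sigma)^\dagger$.
   Context: $\mathbb{Q}_s$ is the real algebra of split quaternions $q=q_1+q_2\mathbf{i}+q_3\mathbf{j}+q_4\mathbf{k}$ ($q_\ell\in\mathbb{R}$) with $\mathbf{i}^2=-1$, $\mathbf{j}^2=\mathbf{k}^2=1$, $\mathbf{i}\mathbf{j}=\mathbf{k}=-\mathbf{j}\mathbf{i}$, $\mathbf{j}\mathbf{k}=-\mathbf{i}=-\mathbf{k}\mathbf{j}$, $\mathbf{k}\mathbf{i}=\mathbf{j}=-\mathbf{i}\mathbf{k}$. A matrix $A\in\mathbb{Q}_s^{m\times n}$ is written $A=A_1+A_2\mathbf{i}+A_3\mathbf{j}+A_4\mathbf{k}$ with $A_\ell\in\mathbb{R}^{m\times n}$. Its real representation is $$A^\sigma=\begin{bmatrix} A_1+A_3 & -A_2+A_4 \\ A_2+A_4 & A_1-A_3 \end{bmatrix}\in\mathbb{R}^{2m\times 2n};$$ the map $\sigma: A\mapsto A^\sigma$ is a bijection $\mathbb{Q}_s^{m\times n}\to\mathbb{R}^{2m\times 2n}$ with inverse $\sigma^{-1}$. The $i$-conjugate transpose is $A^H:=A_1^T-A_2^T\mathbf{i}+A_3^T\mathbf{j}+A_4^T\mathbf{k}\in\mathbb{Q}_s^{n\times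 m}$. For a real matrix $M$, $M^\dagger$ is the usual real Moore--Penrose inverse. *)

theory Defs
  imports "HOL-Analysis.Analysis"
begin

section \<open>The real algebra of split quaternions\<close>

datatype split_quat = SQ (sq1: real) (sq2: real) (sq3: real) (sq4: real)

lemma split_quat_eq_iff:
  "p = q \<longleftrightarrow> sq1 p = sq1 q \<and> sq2 p = sq2 q \<and> sq3 p = sq3 q \<and> sq4 p = sq4 q"
  by (cases p; cases q) simp

instantiation split_quat :: real_algebra_1
begin

definition "0 = SQ 0 0 0 0"

definition "1 = SQ 1 0 0 0"

definition "- p = SQ (- sq1 p) (- sq2 p) (- sq3 p) (- sq4 p)"

definition "p + q = SQ (sq1 p + sq1 q) (sq2 p + sq2 q) (sq3 p + sq3 q) (sq4 p + sq4 q)"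

definition "p - q = SQ (sq1 p - sq1 q) (sq2 p - sq2 q) (sq3 p - sq3 q) (sq4 p - sq4 q)"

definition "r *\<^sub>R p = SQ (r * sq1 p) (r * sq2 p) (r * sq3 p) (r * sq4 p)"

(* Bilinear extension of the multiplication table proved in split_quat_units below. *)
definition
  "p * q = SQ
    (sq1 p * sq1 q - sq2 p * sq2 q + sq3 p * sq3 q + sq4 p * sq4 q)
    (sq1 p * sq2 q + sq2 p * sq1 q - sq3 p * sq4 q + sq4 p * sq3 q)
    (sq1 p * sq3 q + sq3 p * sq1 q - sq2 p * sq4 q + sq4 p * sq2 q)
    (sq1 p * sq4 q + sq4 p * sq1 q + sq2 p * sq3 q - sq3 p * sq2 q)"

instance
  by standard
    (simp_all add: split_quat_eq_iff zero_split_quat_def one_split_quat_def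
      uminus_split_quat_def plus_split_quat_def minus_split_quat_def scaleR_split_quat_def
      times_split_quat_def algebra_simps)

end

definition sq_i :: split_quat where "sq_i = SQ 0 1 0 0"
definition sq_j :: split_quat where "sq_j = SQ 0 0 1 0"
definition sq_k :: split_quat where "sq_k = SQ 0 0 0 1"

lemma split_quat_units:
  "sq_i * sq_i = - 1" "sq_j * sq_j = 1" "sq_k * sq_k = 1"
  "sq_i * sq_j = sq_k" "sq_j * sq_i = - sq_k"
  "sq_j * sq_k = - sq_i" "sq_k * sq_j = sq_i"
  "sq_k * sq_i = sq_j" "sq_i * sq_k = - sq_j"
  by (simp_all add: sq_i_def sq_j_def sq_k_def one_split_quat_def uminus_split_quat_def
      times_split_quat_def)

lemma split_quat_expand:
  "q = of_real (sq1 q) + sq2 q *\<^sub>R sq_i + sq3 q *\<^sub>R sq_j + sq4 q *\<^sub>R sq_k"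
  by (simp add: split_quat_eq_iff of_real_def sq_i_def sq_j_def sq_k_def one_split_quat_def
      plus_split_quat_def scaleR_split_quat_def)

section \<open>Split quaternion matrices\<close>

(* As usual, 'a^'n^'m is the type of matrices with rows indexed by 'm and columns by 'n. *)

definition sq_conj_transpose :: "split_quat^'n^'m \<Rightarrow> split_quat^'m^'n" where
  "sq_conj_transpose A = (\<chi> i j. SQ (sq1 (A$j$i)) (- sq2 (A$j$i)) (sq3 (A$j$i)) (sq4 (A$j$i)))"

(* 2m and 2n become the index types 'm + 'm and 'n + 'n: Inl indexes the first block of
   rows (columns) and Inr the second one. *)
definition real_rep :: "split_quat^'n^'m \<Rightarrow> real^('n + 'n)^('m + 'm)" where
  "real_rep A = (\<chi> r c. case (r, c) of
      (Inl i, Inl j) \<Rightarrow> sq1 (A$i$j) + sq3 (A$i$j)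
    | (Inl i, Inr j) \<Rightarrow> - sq2 (A$i$j) + sq4 (A$i$j)
    | (Inr i, Inl j) \<Rightarrow> sq2 (A$i$j) + sq4 (A$i$j)
    | (Inr i, Inr j) \<Rightarrow> sq1 (A$i$j) - sq3 (A$i$j))"

lemma bij_real_rep: "bij (real_rep :: split_quat^'n^'m \<Rightarrow> real^('n + 'n)^('m + 'm))"
proof (rule bijI)
  show "inj (real_rep :: split_quat^'n^'m \<Rightarrow> real^('n + 'n)^('m + 'm))"
  proof (rule injI)
    fix A B :: "split_quat^'n^'m"
    assume eq: "real_rep A = real_rep B"
    have "A$i$j = B$i$j" for i j
    proof -
      have e: "real_rep A $ r $ c = real_rep B $ r $ c" for r c
        using eq by simp
      show ?thesis
        using e[of "Inl i" "Inl j"] e[of "Inl i" "Inr j"] e[of "Inr i" "Inl j"]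
          e[of "Inr i" "Inr j"]
        by (simp add: real_rep_def split_quat_eq_iff)
    qed
    then show "A = B" by (simp add: vec_eq_iff)
  qed
  show "surj (real_rep :: split_quat^'n^'m \<Rightarrow> real^('n + 'n)^('m + 'm))"
  proof (rule surjI)
    fix M :: "real^('n + 'n)^('m + 'm)"
    show "real_rep (\<chi> i j. SQ
        ((M $ Inl i $ Inl j + M $ Inr i $ Inr j) / 2)
        ((M $ Inr i $ Inl j - M $ Inl i $ Inr j) / 2)
        ((M $ Inl i $ Inl j - M $ Inr i $ Inr j) / 2)
        ((M $ Inr i $ Inl j + M $ Inl i $ Inr j) / 2)) = M"
      by (auto simp: real_rep_def vec_eq_iff field_simps split: sum.splits)
  qed
qed

section \<open>Moore--Penrose inverses\<close>

definition real_pinv :: "real^'n^'m \<Rightarrow> real^'m^'n" where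
  "real_pinv M = (THE X. M ** X ** M = M \<and> X ** M ** X = X \<and>
     transpose (M ** X) = M ** X \<and> transpose (X ** M) = X ** M)"

definition sq_pinv :: "split_quat^'n^'m \<Rightarrow> split_quat^'m^'n" where
  "sq_pinv A = inv real_rep (real_pinv (real_rep A))"

end

theory Submission
  imports Defs
begin

text \<open>The map \<open>\<sigma>\<close> is a bijection that respects products and turns the \<open>i\<close>-conjugate transpose into
  the transpose, so the four equations for \<open>X\<close> are the Penrose equations for \<open>X\<^sup>\<sigma>\<close>, and everything
  reduces to existence and uniqueness of the real Moore--Penrose inverse. For existence, if \<open>G\<close> and
  \<open>H\<close> satisfy \<open>M\<^sup>T M G M\<^sup>T M = M\<^sup>T M\<close> and \<open>M M\<^sup>T H M M\<^sup>T = M M\<^sup>T\<close>, then \<open>(H M)\<^sup>T M (G M\<^sup>T)\<close> is a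
  Moore--Penrose inverse of \<open>M\<close>.\<close>

definition is_pinv :: "real^'n^'m \<Rightarrow> real^'m^'n \<Rightarrow> bool" where
  "is_pinv M X \<longleftrightarrow> M ** X ** M = M \<and> X ** M ** X = X \<and>
     transpose (M ** X) = M ** X \<and> transpose (X ** M) = X ** M"

text \<open>Symmetry makes \<open>M ** X\<close> and \<open>M ** Y\<close> the same orthogonal
  projection, onto the range of \<open>M\<close>; likewise \<open>X ** M = Y ** M\<close>. Then
  \<open>X = X ** M ** X\<close> becomes \<open>Y ** M ** Y = Y\<close>.\<close>

lemma is_pinv_unique:
  assumes X: "is_pinv M X" and Y: "is_pinv M Y"
  shows "X = Y"
proof -
  note X = X[unfolded is_pinv_def] and Y = Y[unfolded is_pinv_def]
  have "M ** X = transpose ((M ** Y) ** (M ** X))"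
    using X Y by (simp add: matrix_mul_assoc)
  also have "\<dots> = M ** X ** (M ** Y)"
    using X Y by (simp only: matrix_transpose_mul)
  also have "\<dots> = M ** Y"
    using X by (simp add: matrix_mul_assoc)
  finally have MX: "M ** X = M ** Y" .
  have "X ** M = transpose ((X ** M) ** (Y ** M))"
    using X Y by (metis matrix_mul_assoc)
  also have "\<dots> = (Y ** M) ** (X ** M)"
    using X Y by (simp only: matrix_transpose_mul)
  also have "\<dots> = Y ** M"
    using X by (metis matrix_mul_assoc)
  finally have XM: "X ** M = Y ** M" .
  have "X = X ** (M ** X)" using X by (simp add: matrix_mul_assoc)
  also have "\<dots> = Y ** M ** Y" by (simp add: MX XM matrix_mul_assoc)
  finally show ?thesis using Y by simp
qed

lemma generalized_inverse_exists:
  fixes M :: "real^'n^'m"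
  obtains G :: "real^'m^'n" where "M ** G ** M = M"
proof -
  \<comment> \<open>\<open>g\<close> picks, linearly, a preimage under \<open>M\<close> of each
    vector in its range.\<close>
  obtain g :: "real^'m \<Rightarrow> real^'n" where g: "linear g" "\<forall>v\<in>range ((*v) M). M *v g v = v"
    using linear_exists_right_inverse_on[OF matrix_vector_mul_linear subspace_UNIV] by blast
  have "M ** matrix g ** M = M"
    using g by (simp add: matrix_eq flip: matrix_vector_mul_assoc)
  then show thesis ..
qed

text \<open>The Gram matrix has the same kernel as \<open>M\<close>, since
  \<open>transpose M *v (M *v v) = 0\<close> forces the squared norm of \<open>M *v v\<close> to
  vanish.\<close>

lemma gram_cancel_left:
  fixes M :: "real^'n^'m" and B C :: "real^'k^'n"
  assumes "transpose M ** M ** B = transpose M ** M ** C"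
  shows "M ** B = M ** C"
proof -
  have "M *v (B *v x) = M *v (C *v x)" for x
  proof -
    define v where "v = B *v x - C *v x"
    have "transpose M *v (M *v v) = 0"
      using assms by (simp add: v_def matrix_vector_mult_diff_distrib matrix_vector_mul_assoc matrix_mul_assoc)
    then have "(M *v v) \<bullet> (M *v v) = 0"
      by (metis dot_lmul_matrix inner_zero_left transpose_matrix_vector)
    then show ?thesis by (simp add: v_def matrix_vector_mult_diff_distrib)
  qed
  then show ?thesis by (simp add: matrix_eq flip: matrix_vector_mul_assoc)
qed

lemma least_squares_inverse_exists:
  fixes M :: "real^'n^'m"
  obtains Y :: "real^'m^'n" where "M ** Y ** M = M" "transpose (M ** Y) = M ** Y"
proof -
  obtain G where G: "transpose M ** M ** G ** (transpose M ** M) = transpose M ** M"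
    using generalized_inverse_exists .
  \<comment> \<open>\<open>P\<close> will be the orthogonal projection onto the range of
    \<open>M\<close>.\<close>
  define P where "P = M ** (G ** transpose M)"
  have "M ** (G ** transpose M ** M) = M ** mat 1"
    by (rule gram_cancel_left) (use G in \<open>simp add: matrix_mul_assoc\<close>)
  then have PM: "P ** M = M" by (simp add: P_def matrix_mul_assoc)
  \<comment> \<open>The left side is symmetric, hence so is \<open>transpose P\<close>.\<close>
  have "P ** transpose P = transpose P"
    using PM by (simp add: P_def matrix_transpose_mul matrix_mul_assoc)
  then have "transpose P = P"
    by (metis matrix_transpose_mul transpose_transpose)
  with PM show thesis using that by (simp add: P_def)
qed

lemma is_pinv_exists:
  fixes M :: "real^'n^'m"
  obtains X where "is_pinv M X"
proof -
  obtain Y where Y: "M ** Y ** M = M" "transpose (M ** Y) = M ** Y"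
    using least_squares_inverse_exists .
  \<comment> \<open>Transposing a least-squares inverse of \<open>transpose M\<close> moves the
    symmetry to the other product, \<open>Z ** M\<close>.\<close>
  obtain W where W: "transpose M ** W ** transpose M = transpose M"
      "transpose (transpose M ** W) = transpose M ** W"
    using least_squares_inverse_exists .
  define Z where "Z = transpose W"
  have Z: "M ** Z ** M = M" "transpose (Z ** M) = Z ** M"
    using arg_cong[OF W(1), of transpose] W(2)
    by (simp_all add: Z_def matrix_transpose_mul matrix_mul_assoc)
  \<comment> \<open>The product \<open>Z ** M ** Y\<close> inherits one symmetric projection from
    each factor: \<open>M ** Y\<close> on the left of it, \<open>Z ** M\<close> on the
    right.\<close>
  have MX: "M ** (Z ** M ** Y) = M ** Y"
    using Z by (simp add: matrix_mul_assoc)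
  have XM: "Z ** M ** Y ** M = Z ** M"
    using Y by (metis matrix_mul_assoc)
  have "is_pinv M (Z ** M ** Y)"
    unfolding is_pinv_def MX XM using Y Z by (metis matrix_mul_assoc)
  then show thesis ..
qed

lemma is_pinv_real_pinv: "is_pinv M X \<longleftrightarrow> X = real_pinv M"
proof -
  have "\<exists>!X. is_pinv M X"
    by (metis is_pinv_exists is_pinv_unique)
  moreover have "real_pinv M = (THE X. is_pinv M X)"
    by (simp add: real_pinv_def is_pinv_def)
  ultimately show ?thesis by (metis theI')
qed

lemma sum_UNIV_Plus:
  fixes f :: "'a::finite + 'b::finite \<Rightarrow> 'c::comm_monoid_add"
  shows "sum f UNIV = (\<Sum>x\<in>UNIV. f (Inl x)) + (\<Sum>x\<in>UNIV. f (Inr x))"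
  by (simp add: sum.Plus flip: UNIV_Plus_UNIV)

lemma sq_sum [simp]:
  "sq1 (sum f S) = (\<Sum>x\<in>S. sq1 (f x))" "sq2 (sum f S) = (\<Sum>x\<in>S. sq2 (f x))"
  "sq3 (sum f S) = (\<Sum>x\<in>S. sq3 (f x))" "sq4 (sum f S) = (\<Sum>x\<in>S. sq4 (f x))"
  by (induction S rule: infinite_finite_induct;
      simp add: zero_split_quat_def plus_split_quat_def)+

text \<open>Entrywise this is the representation of split quaternions by real 2 by 2 matrices; the
  sum over the doubled index splits into two blocks.\<close>

lemma real_rep_mult: "real_rep (A ** B) = real_rep A ** real_rep B"
  by (auto simp: vec_eq_iff real_rep_def matrix_matrix_mult_def sum_UNIV_Plus times_split_quat_def
      algebra_simps simp flip: sum.distrib sum_subtractf sum_negf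
      intro!: sum.cong split: sum.splits)

text \<open>Only \<open>sq_i\<close> is represented by an antisymmetric 2 by 2 matrix, so only its
  coefficient changes sign.\<close>

lemma real_rep_conj_transpose: "real_rep (sq_conj_transpose A) = transpose (real_rep A)"
  by (auto simp: vec_eq_iff real_rep_def sq_conj_transpose_def transpose_def split: sum.splits)

lemma real_rep_eq_iff: "real_rep A = real_rep B \<longleftrightarrow> A = B"
  using bij_real_rep by (metis bij_pointE)

lemma is_pinv_real_rep_iff:
  "is_pinv (real_rep A) (real_rep X) \<longleftrightarrow>
    A ** X ** A = A \<and> X ** A ** X = X \<and>
    sq_conj_transpose (A ** X) = A ** X \<and> sq_conj_transpose (X ** A) = X ** A"
  by (simp add: is_pinv_def real_rep_eq_iff flip: real_rep_mult real_rep_conj_transpose)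

theorem theorem3p4:
  fixes A :: "split_quat^'n^'m"
  shows "(\<forall>X :: split_quat^'m^'n.
           (A ** X ** A = A \<and> X ** A ** X = X \<and>
            sq_conj_transpose (A ** X) = A ** X \<and> sq_conj_transpose (X ** A) = X ** A)
           \<longleftrightarrow> X = sq_pinv A)
       \<and> real_rep (sq_pinv A) = real_pinv (real_rep A)"
proof -
  have rep: "real_rep (sq_pinv A) = real_pinv (real_rep A)"
    by (simp add: sq_pinv_def surj_f_inv_f bij_is_surj[OF bij_real_rep])
  show ?thesis
    unfolding is_pinv_real_rep_iff[symmetric] is_pinv_real_pinv
    by (simp add: real_rep_eq_iff flip: rep)
qed

end
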